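(* Let $\lambda = (h_1 +h_2 -l_1-l_2 -\alpha _1-\alpha _2+1 )/2$ and let $(i,i')=(1,2)$ or $(2,1)$. Then the function $$g (x)= x^{-\alpha _1 } \sum _{n=0}^{\infty} \Big( \frac{q^{h_i+1/2} t_i}{x} ;q \Big)_n \frac{(q^{\lambda +\alpha _1 };q )_n }{(q^{h_i - l_{i'} +1} t_i/t_{i'} ;q )_n }\, q^n \sum _{k=0}^n \frac{(q^{\lambda -h_{i'} +l_{i'} +\alpha _1} ;q)_k }{(q^{h_i-l_i+1};q)_{k}\, (q;q)_k\, (q;q)_{n-k} }\, q^{k(k+1)/2} \Big(-q^{h_i-l_{i'} }\frac{t_i}{t_ {i'}}\Big)^k$$ is a (formal) solution of the variant of the $q$-hypergeometric equation of degree two, i.e. of $$(x-q^{h_1 +1/2} t_1) (x - q^{h_2 +1/2} t_2)\, g(x/q) + q^{\alpha _1 +\alpha _2} (x - q^{l_1-1/2}t_1 ) (x - q^{l_2 -1/2} t_2)\, g(q x) -\big[ (q^{\alpha _1} +q^{\alpha _2} ) x^2 +E x + p ( q^{1/2}+ q^{-1/2}) t_1 t_2 \big]\, g(x) =0,$$ where $p= q^{(h_1 +h_2 + l_1 + l_2 +\alpha _1 +\alpha _2 )/2 }$ and $E= -p \{ (q^{- h_2 }+q^{-l_2 })t_1 + (q^{- h_1 }+ q^{- l_1 }) t_2 \}$.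
   Context: Here $q$ is a fixed nonzero complex number that is not a root of unity, with a fixed choice of $\log q$ so that $q^s=e^{s\log q}$; $h_1,h_2,l_1,l_2,\alpha_1,\alpha_2$ are complex parameters and $t_1,t_2$ are nonzero complex parameters, such that no denominator appearing vanishes. The $q$-Pochhammer symbol is $(a;q)_0=1$, $(a;q)_n=(1-a)(1-aq)\cdots(1-aq^{n-1})$ for $n\ge 1$. The power $x^{s}$ satisfies $(q^{\pm1}x)^{s}=q^{\pm s}x^{s}$. Infinite sums are treated formally and convergence is not discussed. Precisely, put $P_n(x)=\big(q^{h_i+1/2}t_i/x;q\big)_n$, which form a basis of the polynomials in $1/x$, and let $L$ be the linear operator sending $g$ to the left-hand side of the equation. For each $n\ge 0$, $x^{\alpha_1-2}L[x^{-\alpha_1}P_n]$ is a polynomial in $1/x$ which is a linear combination of the $P_m$ with $\max(n-1,0)\le m\le n+2$. A formal series $g=x^{-\alpha_1}\sum_{n\ge0}c_nP_n(x)$ is a formal solution if, applying $x^{\alpha_1-2}L$ termwise, writing each term as such a linear combination of the $P_m$, and collecting terms, the total coefficient (a finite sum) of each $P_m$, $m\ge0$, is zero. *)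

theory Defs
  imports Complex_Main
begin

(* The power q^s for the choice lq of log q. *)
definition qpow :: "complex \<Rightarrow> complex \<Rightarrow> complex" where
  "qpow lq s = exp (s * lq)"

definition qpoch :: "complex \<Rightarrow> complex \<Rightarrow> nat \<Rightarrow> complex" where
  "qpoch a q n = (\<Prod>k<n. 1 - a * q ^ k)"

(* u is a version of the function x \<mapsto> x^s on the nonzero complex numbers. No branch is
   chosen: all that is required is (q^{\<plusminus>1} x)^s = q^{\<plusminus>s} x^s and that u has no zeros, so
   that x^{-s} makes sense. *)
definition is_q_power :: "complex \<Rightarrow> complex \<Rightarrow> complex \<Rightarrow> (complex \<Rightarrow> complex) \<Rightarrow> bool" where
  "is_q_power q lq s u \<longleftrightarrow>
     (\<forall>x. x \<noteq> 0 \<longrightarrow> u x \<noteq> 0 \<and> u (q * x) = qpow lq s * u x \<and> u (x / q) = qpow lq (- s) * u x)"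

(* Left-hand side of the variant of the q-hypergeometric equation of degree two; the
   parameter families h, l, t, \<alpha> are indexed by 1 and 2. *)
definition qhg2_op ::
  "complex \<Rightarrow> complex \<Rightarrow> (nat \<Rightarrow> complex) \<Rightarrow> (nat \<Rightarrow> complex) \<Rightarrow> (nat \<Rightarrow> complex) \<Rightarrow> (nat \<Rightarrow> complex) \<Rightarrow>
   (complex \<Rightarrow> complex) \<Rightarrow> complex \<Rightarrow> complex" where
  "qhg2_op q lq h l t \<alpha> g x =
    (let p = qpow lq ((h 1 + h 2 + l 1 + l 2 + \<alpha> 1 + \<alpha> 2) / 2);
         E = - p * ((qpow lq (- h 2) + qpow lq (- l 2)) * t 1
                  + (qpow lq (- h 1) + qpow lq (- l 1)) * t 2)
     in (x - qpow lq (h 1 + 1/2) * t 1) * (x - qpow lq (h 2 + 1/2) * t 2) * g (x / q)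
      + qpow lq (\<alpha> 1 + \<alpha> 2)
          * (x - qpow lq (l 1 - 1/2) * t 1) * (x - qpow lq (l 2 - 1/2) * t 2) * g (q * x)
      - ((qpow lq (\<alpha> 1) + qpow lq (\<alpha> 2)) * x\<^sup>2 + E * x
          + p * (qpow lq (1/2) + qpow lq (- 1/2)) * t 1 * t 2) * g x)"

(* The formal series u(x) * (\<Sum>n. c n * P n x), with u(x) = x^{-\<alpha>\<^sub>1}, solves L g = 0: after applying
   x^{\<alpha>\<^sub>1 - 2} L, i.e. L followed by division by x^2 u(x), to the n-th term, the result
   is \<Sum>m. d n m * P m x with max(n-1,0) \<le> m \<le> n+2 (subtraction on nat truncates), and for each m
   the coefficients of P m add up to 0. The indices n with max(n-1,0) \<le> m \<le> n+2 are
   exactly those in {m - 2..m + 1}. If the P m are linearly independent as functions of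
   x \<noteq> 0, the relevant values d n m are uniquely determined. *)
definition formal_solution ::
  "((complex \<Rightarrow> complex) \<Rightarrow> complex \<Rightarrow> complex) \<Rightarrow> (complex \<Rightarrow> complex) \<Rightarrow>
   (nat \<Rightarrow> complex \<Rightarrow> complex) \<Rightarrow> (nat \<Rightarrow> complex) \<Rightarrow> bool" where
  "formal_solution L u P c \<longleftrightarrow>
    (\<exists>d :: nat \<Rightarrow> nat \<Rightarrow> complex.
       (\<forall>n x. x \<noteq> 0 \<longrightarrow>
          L (\<lambda>y. u y * (c n * P n y)) x / (x\<^sup>2 * u x) = (\<Sum>m = n - 1..n + 2. d n m * P m x)) \<and>
       (\<forall>m. (\<Sum>n = m - 2..m + 1. d n m) = 0))"

end

theory Submission
  imports Defs "HOL-Computational_Algebra.Formal_Power_Series"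
begin

unbundle fps_syntax

text \<open>
  Put \<open>y = q\<^bsup>h\<^sub>i+1/2\<^esup> t\<^sub>i / x\<close>, so that the expansion functions are \<open>P\<^sub>n = (y;q)\<^sub>n\<close>. Up to a constant
  factor, the equation depends on just four parameters: with \<open>\<sigma> = q\<^bsup>\<lambda>+\<alpha>\<^sub>1\<^esup>\<close>,
  \<open>\<tau> = q\<^bsup>h\<^sub>i-l\<^sub>i'+1\<^esup> t\<^sub>i / t\<^sub>i'\<close>, \<open>\<rho> = q\<^bsup>h\<^sub>i-l\<^sub>i+1\<^esup>\<close> and \<open>\<mu> = q\<^bsup>\<lambda>-h\<^sub>i'+l\<^sub>i'+\<alpha>\<^sub>1\<^esup>\<close>,
  all of which occur in the coefficients of the series, the operator becomes \<open>reduced_op\<close>, whose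
  coefficients are polynomials in \<open>y, \<sigma>, \<tau>, \<rho>, \<mu>, q\<close> (\<open>qhg2_op_eq_reduced_op\<close>).

  The factor \<open>1 - y\<close> in front of \<open>f(qy)\<close> turns \<open>(qy;q)\<^sub>n\<close> into \<open>P\<^sub>n\<^sub>+\<^sub>1\<close>, and \<open>(y/q;q)\<^sub>n\<close> is
  \<open>(1 - y/q) P\<^sub>n\<^sub>-\<^sub>1\<close>, so \<open>reduced_op\<close> maps \<open>P\<^sub>n\<close> to a combination of \<open>P\<^sub>n\<^sub>-\<^sub>1, \<dots>, P\<^sub>n\<^sub>+\<^sub>2\<close>
  (\<open>reduced_op_qpoch\<close>). The series \<open>\<Sum>c\<^sub>n P\<^sub>n\<close> is therefore a formal solution as soon as its
  coefficients satisfy a certain recurrence with four terms.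

  The coefficients are \<open>c\<^sub>n = (\<sigma>)\<^sub>n / (\<tau>)\<^sub>n q\<^sup>n S\<^sub>n\<close>, where \<open>S\<^sub>n\<close> is the inner sum and does not involve
  \<open>\<sigma>\<close>. As a Cauchy product, \<open>S\<^sub>n\<close> has the generating function \<open>F = f e\<close>, where
  \<open>e(w) = \<Sum>w\<^sup>n/(q)\<^sub>n\<close> satisfies \<open>e(qw) = (1 - w) e(w)\<close> and \<open>f\<close> is a basic hypergeometric series
  \<open>\<^sub>1\<phi>\<^sub>1(\<mu>; \<rho>; q, \<tau>w)\<close>, which satisfies a \<open>q\<close>-difference equation of second order. Hence so does \<open>F\<close>,
  and comparing coefficients gives a recurrence \<open>R\<^sub>n = 0\<close> for \<open>S\<close> with only three terms
  (\<open>inner_sum_recurrence\<close>).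

  Finally, the left-hand side of the four-term recurrence is, up to a common factor,
  \<open>q\<^sup>2 (1 - \<tau> q\<^bsup>m-1\<^esup>) R\<^sub>m\<^sub>-\<^sub>1 - (1 - \<sigma> q\<^sup>m) R\<^sub>m\<close> (\<open>series_coeff_recurrence\<close>).
\<close>

section \<open>The operator on the q-Pochhammer basis\<close>

lemma qpoch_0 [simp]: "qpoch a q 0 = 1"
  by (simp add: qpoch_def)

lemma qpoch_Suc: "qpoch a q (Suc n) = qpoch a q n * (1 - a * q ^ n)"
  by (simp add: qpoch_def)

lemma qpoch_Suc_left: "qpoch a q (Suc n) = (1 - a) * qpoch (q * a) q n"
  unfolding qpoch_def by (subst prod.lessThan_Suc_shift) (simp add: mult_ac)

lemma qpoch_div_Suc:
  assumes "q \<noteq> 0"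
  shows "qpoch (a / q) q (Suc n) = (1 - a / q) * qpoch a q n"
  using assms by (simp add: qpoch_Suc_left)

text \<open>
  This quadratic polynomial in \<open>N = q\<^sup>n\<close> is the coefficient of \<open>S\<^sub>n\<close> in the three-term recurrence
  of the inner sums. It also occurs in the coefficients of the operator in the basis
  \<open>(y;q)\<^sub>n\<close>, which is what allows the four-term recurrence to be reduced to the three-term one.
\<close>

definition mid_coeff :: "complex \<Rightarrow> complex \<Rightarrow> complex \<Rightarrow> complex \<Rightarrow> complex \<Rightarrow> complex" where
  "mid_coeff q \<tau> \<rho> \<mu> N = 1 + q - (q + \<rho> + \<tau>) * N + \<tau> * \<mu> * N\<^sup>2"

text \<open>
  The matrix entries of \<open>reduced_op\<close> below in the basis \<open>(y;q)\<^sub>n\<close>. For \<open>n = 0\<close> the entry that would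
  belong to \<open>m = n - 1\<close> has the factor \<open>1 - q\<^sup>0 = 0\<close>, so the same formulas cover this case.
\<close>

definition op_coeff ::
  "complex \<Rightarrow> complex \<Rightarrow> complex \<Rightarrow> complex \<Rightarrow> complex \<Rightarrow> nat \<Rightarrow> nat \<Rightarrow> complex" where
  "op_coeff q \<sigma> \<tau> \<rho> \<mu> n m =
     (let N = q ^ n; B = mid_coeff q \<tau> \<rho> \<mu> N in
       (if Suc m = n then - ((1 - N) * (q - \<rho> * N) * (q - \<tau> * N))
        else if m = n then (1 - \<sigma> * N) * B + (1 - N) * (q - \<rho> * N) * (q - \<tau> * N)
        else if m = Suc n then - ((1 - \<sigma> * N) * (B + 1 / q - \<sigma> * N))
        else if m = Suc (Suc n) then (1 - \<sigma> * N) * (1 - \<sigma> * q * N) / q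
        else 0) / N ^ 3)"

text \<open>
  The operator \<open>x\<^bsup>\<alpha>\<^sub>1-2\<^esup> L x\<^bsup>-\<alpha>\<^sub>1\<^esup>\<close> in the variable \<open>y\<close>, which is inversely proportional to \<open>x\<close> (so that
  \<open>x/q\<close> corresponds to \<open>q y\<close>), multiplied by a constant that clears the denominators in \<open>\<sigma>\<close>, \<open>\<tau>\<close>, \<open>\<rho>\<close>, \<open>\<mu>\<close>.
\<close>

definition reduced_op ::
  "complex \<Rightarrow> complex \<Rightarrow> complex \<Rightarrow> complex \<Rightarrow> complex \<Rightarrow> (complex \<Rightarrow> complex) \<Rightarrow> complex \<Rightarrow> complex" where
  "reduced_op q \<sigma> \<tau> \<rho> \<mu> f y =
     \<sigma> * (1 - y) * (\<tau> * \<mu> - \<sigma> * q * y) * f (q * y)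
     + (\<rho> - y) * (\<tau> - y) * f (y / q)
     - (\<sigma> * \<tau> * \<mu> + \<rho> * \<tau> - (\<sigma> * (q + \<rho> + \<tau>) + \<tau> * \<mu>) * y + \<sigma> * (1 + q) * y\<^sup>2) * f y"

text \<open>
  All three terms are multiples of \<open>(y;q)\<^sub>n\<^sub>-\<^sub>1\<close>, and after dividing by it an identity of cubic
  polynomials in \<open>y\<close> remains. The operator does not lead further than to \<open>n + 2\<close> and \<open>n - 1\<close> because
  its coefficients are quadratic and the one in front of \<open>f(qy)\<close> vanishes at \<open>y = 1\<close>.
\<close>

lemma reduced_op_qpoch:
  assumes "q \<noteq> 0"
  shows "reduced_op q \<sigma> \<tau> \<rho> \<mu> (\<lambda>y. qpoch y q n) y
           = (\<Sum>m = n - 1..n + 2. op_coeff q \<sigma> \<tau> \<rho> \<mu> n m * qpoch y q m)"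
proof (cases n)
  case 0
  have set: "{n - 1..n + 2} = {0, Suc 0, Suc (Suc 0)}"
    using 0 by auto
  show ?thesis
    unfolding set using assms
    by (simp add: 0 reduced_op_def op_coeff_def mid_coeff_def qpoch_Suc)
       (simp add: divide_simps, algebra)
next
  case (Suc k)
  define N where "N = q ^ k"
  have N: "N \<noteq> 0" using assms by (simp add: N_def)
  define p where "p = qpoch y q k"
  have set: "{n - 1..n + 2} = {k, Suc k, Suc (Suc k), Suc (Suc (Suc k))}"
    using Suc by auto
  have up: "(1 - y) * qpoch (q * y) q n = p * (1 - y * N) * (1 - y * (q * N))"
    unfolding qpoch_Suc_left[symmetric] by (simp add: Suc qpoch_Suc p_def N_def)
  have down: "qpoch (y / q) q n = (1 - y / q) * p"
    using assms by (simp add: Suc qpoch_div_Suc p_def)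
  have "reduced_op q \<sigma> \<tau> \<rho> \<mu> (\<lambda>y. qpoch y q n) y
     = \<sigma> * (\<tau> * \<mu> - \<sigma> * q * y) * (p * (1 - y * N) * (1 - y * (q * N)))
       + (\<rho> - y) * (\<tau> - y) * ((1 - y / q) * p)
       - (\<sigma> * \<tau> * \<mu> + \<rho> * \<tau> - (\<sigma> * (q + \<rho> + \<tau>) + \<tau> * \<mu>) * y + \<sigma> * (1 + q) * y\<^sup>2)
         * (p * (1 - y * N))"
    unfolding reduced_op_def down up[symmetric]
    by (simp add: Suc qpoch_Suc p_def N_def algebra_simps)
  also have "\<dots> = (\<Sum>m = n - 1..n + 2. op_coeff q \<sigma> \<tau> \<rho> \<mu> n m * qpoch y q m)"
    unfolding set using assms N
    by (simp add: Suc op_coeff_def mid_coeff_def qpoch_Suc Let_def flip: N_def p_def)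
       (simp add: divide_simps, algebra)
  finally show ?thesis .
qed

section \<open>The three-term recurrence of the inner sums\<close>

text \<open>
  The substitution \<open>w \<mapsto> q w\<close>. In terms of it, a \<open>q\<close>-difference equation for a generating function
  is a recurrence for its coefficients.
\<close>

definition dilate :: "complex \<Rightarrow> complex fps \<Rightarrow> complex fps" where
  "dilate q F = fps_compose F (fps_const q * fps_X)"

lemma dilate_nth [simp]: "dilate q F $ n = q ^ n * F $ n"
  by (simp add: dilate_def fps_compose_linear)

lemma dilate_mult: "dilate q (F * G) = dilate q F * dilate q G"
  by (simp add: dilate_def fps_compose_mult_distrib)

text \<open>
  The coefficients of \<open>\<^sub>1\<phi>\<^sub>1(\<mu>; \<rho>; q, \<tau>w)\<close>: since \<open>k(k+1)/2 - k = k(k-1)/2\<close>, the last two factors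
  combine to \<open>(-\<tau>)\<^sup>k q\<^bsup>k(k-1)/2\<^esup>\<close>.
\<close>

definition numer_coeff :: "complex \<Rightarrow> complex \<Rightarrow> complex \<Rightarrow> complex \<Rightarrow> nat \<Rightarrow> complex" where
  "numer_coeff q \<tau> \<rho> \<mu> k = qpoch \<mu> q k / (qpoch \<rho> q k * qpoch q q k)
      * q ^ (k * (k + 1) div 2) * (- \<tau> / q) ^ k"

definition inner_sum :: "complex \<Rightarrow> complex \<Rightarrow> complex \<Rightarrow> complex \<Rightarrow> nat \<Rightarrow> complex" where
  "inner_sum q \<tau> \<rho> \<mu> n = (\<Sum>k = 0..n. numer_coeff q \<tau> \<rho> \<mu> k / qpoch q q (n - k))"

lemma qpoch_q_nonzero:
  assumes "\<And>n. n \<ge> 1 \<Longrightarrow> q ^ n \<noteq> 1"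
  shows "qpoch q q n \<noteq> 0"
  using assms[of "Suc _"] by (auto simp: qpoch_def)

lemma numer_coeff_Suc:
  assumes "q \<noteq> 0" "\<And>n. n \<ge> 1 \<Longrightarrow> q ^ n \<noteq> 1" "\<And>n. qpoch \<rho> q n \<noteq> 0"
  shows "(1 - \<rho> * q ^ k) * (1 - q ^ Suc k) * numer_coeff q \<tau> \<rho> \<mu> (Suc k)
           = - \<tau> * q ^ k * (1 - \<mu> * q ^ k) * numer_coeff q \<tau> \<rho> \<mu> k"
proof -
  have tri: "q ^ (Suc k * (Suc k + 1) div 2) = q ^ (k * (k + 1) div 2) * (q * q ^ k)"
  proof -
    have "Suc k * (Suc k + 1) div 2 = k * (k + 1) div 2 + Suc k"
      by simp
    then show ?thesis
      by (simp only: power_add power_Suc)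
  qed
  have "1 - \<rho> * q ^ k \<noteq> 0" "1 - q * q ^ k \<noteq> 0" "qpoch q q k \<noteq> 0" "qpoch \<rho> q k \<noteq> 0"
    using assms(3)[of "Suc k"] assms(2)[of "Suc k"] qpoch_q_nonzero[OF assms(2)] assms(3)
    by (auto simp: qpoch_Suc)
  then show ?thesis
    using assms(1)
    unfolding numer_coeff_def tri
    by (simp add: qpoch_Suc divide_simps)
qed

text \<open>
  The recurrence is the coefficient of \<open>w\<^bsup>n+1\<^esup>\<close> in a second-order \<open>q\<close>-difference equation for the generating
  function \<open>F = f e\<close> of the inner sums. Multiplying the equation of \<open>f\<close> by \<open>e(q\<^sup>2w)\<close>, which is
  \<open>(1 - w) (1 - q w) e(w)\<close> and \<open>(1 - q w) e(q w)\<close>, yields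
  \<open>q (1 - w) (1 - q w) F(w) - (1 - q w) (q + \<rho> - q \<tau> w) F(q w) + (\<rho> - q \<tau> \<mu> w) F(q\<^sup>2 w) = 0\<close>.
\<close>

lemma inner_sum_recurrence:
  fixes q \<tau> \<rho> \<mu> :: complex
  assumes "q \<noteq> 0" "\<And>n. n \<ge> 1 \<Longrightarrow> q ^ n \<noteq> 1" "\<And>n. qpoch \<rho> q n \<noteq> 0"
  defines "S \<equiv> inner_sum q \<tau> \<rho> \<mu>"
  shows "(1 - q ^ Suc n) * (1 - \<rho> * q ^ n) * S (Suc n) - mid_coeff q \<tau> \<rho> \<mu> (q ^ n) * S n
           + (if n = 0 then 0 else (q - \<tau> * q ^ n) * S (n - 1)) = 0"
proof -
  define e f where "e = Abs_fps (\<lambda>n. 1 / qpoch q q n)" and "f = Abs_fps (numer_coeff q \<tau> \<rho> \<mu>)"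
  define F where "F = f * e"
  let ?T = "dilate q" and ?c = "\<lambda>a. fps_const a :: complex fps"
  have S: "F $ n = S n" for n
    by (simp add: F_def fps_mult_nth S_def inner_sum_def e_def f_def)
  have Te: "?T e = (1 - fps_X) * e"
  proof (rule fps_ext)
    show "?T e $ n = ((1 - fps_X) * e) $ n" for n
    proof (cases n)
      case (Suc k)
      have "1 - q * q ^ k \<noteq> 0" "qpoch q q k \<noteq> 0"
        using assms(2)[of "Suc k"] qpoch_q_nonzero[OF assms(2)] by auto
      then show ?thesis
        by (simp add: Suc e_def left_diff_distrib qpoch_Suc field_simps)
    qed (simp add: e_def left_diff_distrib)
  qed
  have TTe: "?T (?T e) = (1 - ?c q * fps_X) * ?T e"
  proof (rule fps_ext)
    show "?T (?T e) $ n = ((1 - ?c q * fps_X) * ?T e) $ n" for n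
      using arg_cong[OF Te, of "\<lambda>G. G $ n"]
      by (cases n) (simp_all add: left_diff_distrib mult.assoc, simp add: algebra_simps)
  qed
  have Tf: "?c q * f - ?c (q + \<rho>) * ?T f + ?c \<rho> * ?T (?T f)
              = - ?c (q * \<tau>) * fps_X * (?T f - ?c \<mu> * ?T (?T f))"
  proof (rule fps_ext)
    show "(?c q * f - ?c (q + \<rho>) * ?T f + ?c \<rho> * ?T (?T f)) $ n
            = (- ?c (q * \<tau>) * fps_X * (?T f - ?c \<mu> * ?T (?T f))) $ n" for n
    proof (cases n)
      case (Suc k)
      show ?thesis
        using arg_cong[OF numer_coeff_Suc[OF assms(1-3), where k = k], of "\<lambda>z. q * z"]
        by (simp add: Suc f_def mult.assoc) (simp add: algebra_simps)
    qed (simp add: f_def mult.assoc algebra_simps)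
  qed
  let ?Q = "?c q" and ?R = "?c \<rho>" and ?A = "?c \<tau>" and ?M = "?c \<mu>" and ?X = "fps_X :: complex fps"
  \<comment> \<open>The left-hand side of the equation of \<open>F\<close>, expanded into monomials in the constants and \<open>w\<close> so
    that its coefficients can be read off.\<close>
  define Z where "Z = ?Q * F - ?Q * (?X * F) - ?Q * (?Q * (?X * F)) + ?Q * (?Q * (?X * (?X * F)))
          - ?Q * ?T F - ?R * ?T F + ?Q * (?Q * (?X * ?T F)) + ?Q * (?R * (?X * ?T F)) + ?Q * (?A * (?X * ?T F))
          - ?Q * (?Q * (?A * (?X * (?X * ?T F))))
          + ?R * ?T (?T F) - ?Q * (?A * (?M * (?X * ?T (?T F))))"
  have "Z = 0"
    using Tf Te TTe
    unfolding Z_def F_def dilate_mult fps_const_mult[symmetric] fps_const_add[symmetric]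
    by algebra
  moreover have "Z $ Suc n = q * ((1 - q ^ Suc n) * (1 - \<rho> * q ^ n) * S (Suc n)
      - mid_coeff q \<tau> \<rho> \<mu> (q ^ n) * S n + (if n = 0 then 0 else (q - \<tau> * q ^ n) * S (n - 1)))"
    by (cases n; simp add: Z_def S mid_coeff_def power2_eq_square del: fps_const_mult)
       (simp_all add: algebra_simps)
  ultimately show ?thesis
    using assms(1) by simp
qed

section \<open>The four-term recurrence of the series coefficients\<close>

definition series_coeff :: "complex \<Rightarrow> complex \<Rightarrow> complex \<Rightarrow> complex \<Rightarrow> complex \<Rightarrow> nat \<Rightarrow> complex" where
  "series_coeff q \<sigma> \<tau> \<rho> \<mu> n = qpoch \<sigma> q n / qpoch \<tau> q n * q ^ n * inner_sum q \<tau> \<rho> \<mu> n"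

text \<open>
  Let \<open>R\<^sub>n\<close> be the left-hand side of \<open>inner_sum_recurrence\<close>, with \<open>R\<^sub>-\<^sub>1 = 0\<close>. The sum equals
  \<open>(\<sigma>)\<^sub>m / ((\<tau>)\<^sub>m q\<^bsup>2m\<^esup>)\<close> times \<open>q\<^sup>2 (1 - \<tau> q\<^bsup>m-1\<^esup>) R\<^sub>m\<^sub>-\<^sub>1 - (1 - \<sigma> q\<^sup>m) R\<^sub>m\<close>: the terms \<open>S\<^sub>m\<^sub>+\<^sub>1\<close> and
  \<open>S\<^sub>m\<^sub>-\<^sub>2\<close> fix the two multipliers, and the other two terms then agree as well.
\<close>

lemma series_coeff_recurrence:
  fixes q \<sigma> \<tau> \<rho> \<mu> :: complex
  assumes "q \<noteq> 0" "\<And>n. n \<ge> 1 \<Longrightarrow> q ^ n \<noteq> 1" "\<And>n. qpoch \<rho> q n \<noteq> 0" "\<And>n. qpoch \<tau> q n \<noteq> 0"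
  defines "c \<equiv> series_coeff q \<sigma> \<tau> \<rho> \<mu>" and "D \<equiv> op_coeff q \<sigma> \<tau> \<rho> \<mu>"
  shows "(\<Sum>n = m - 2..m + 1. c n * D n m) = 0"
proof -
  define S where "S = inner_sum q \<tau> \<rho> \<mu>"
  define M W where "M = q ^ m" and "W = qpoch \<sigma> q m / qpoch \<tau> q m / M\<^sup>2"
  have M: "M \<noteq> 0" using assms(1) by (simp add: M_def)
  have \<tau>: "1 - \<tau> * q ^ n \<noteq> 0" for n
    using assms(4)[of "Suc n"] by (simp add: qpoch_Suc)
  have R: "(1 - q ^ Suc n) * (1 - \<rho> * q ^ n) * S (Suc n) - mid_coeff q \<tau> \<rho> \<mu> (q ^ n) * S n
           + (if n = 0 then 0 else (q - \<tau> * q ^ n) * S (n - 1)) = 0" for n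
    unfolding S_def by (rule inner_sum_recurrence[OF assms(1-3)])
  \<comment> \<open>The common factor \<open>W\<close> is extracted from each of the four terms.\<close>
  have last: "c (Suc m) * D (Suc m) m
      = - (W * (1 - \<sigma> * M) * ((1 - q * M) * (1 - \<rho> * M) * S (Suc m)))"
  proof -
    have "D (Suc m) m = - ((1 - q * M) * (q * (1 - \<rho> * M)) * (q * (1 - \<tau> * M)) / (q * M) ^ 3)"
    proof -
      have "q - a * (q * M) = q * (1 - a * M)" for a
        by (simp add: algebra_simps)
      then show ?thesis
        by (simp add: D_def op_coeff_def Let_def flip: M_def)
    qed
    moreover have "c (Suc m) = qpoch \<sigma> q m * (1 - \<sigma> * M) / (qpoch \<tau> q m * (1 - \<tau> * M)) * (q * M) * S (Suc m)"
      by (simp add: c_def series_coeff_def qpoch_Suc S_def flip: M_def)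
    ultimately show ?thesis
      using assms(1) M \<tau>[of m, folded M_def]
      by (simp add: W_def power2_eq_square power3_eq_cube)
  qed
  have diag: "c m * D m m = W * ((1 - \<sigma> * M) * mid_coeff q \<tau> \<rho> \<mu> M
                                 + (1 - M) * (q - \<rho> * M) * (q - \<tau> * M)) * S m"
    using M by (simp add: c_def D_def series_coeff_def op_coeff_def W_def power2_eq_square
                  power3_eq_cube S_def Let_def flip: M_def)
  have prev: "c k * D k m = - W * (1 - \<tau> * N) * (q * (1 - \<sigma> * M) + q\<^sup>2 * mid_coeff q \<tau> \<rho> \<mu> N) * S k"
    if "m = Suc k" "N = q ^ k" for k N
  proof -
    let ?B = "mid_coeff q \<tau> \<rho> \<mu> N"
    have N: "N \<noteq> 0" "M = q * N" "1 - \<tau> * N \<noteq> 0"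
      using that assms(1) \<tau>[of k] by (simp_all add: M_def)
    have "D k m = - ((1 - \<sigma> * N) * (?B + 1 / q - \<sigma> * N)) / N ^ 3"
      by (simp add: that(1) D_def op_coeff_def Let_def flip: that(2))
    moreover have "c k = qpoch \<sigma> q k / qpoch \<tau> q k * N * S k"
      by (simp add: c_def series_coeff_def S_def that(2))
    moreover have "W = qpoch \<sigma> q k * (1 - \<sigma> * N) / (qpoch \<tau> q k * (1 - \<tau> * N)) / (q * N)\<^sup>2"
      unfolding W_def N(2) by (simp add: that(1) qpoch_Suc flip: that(2))
    moreover have "q * (1 - \<sigma> * M) + q\<^sup>2 * ?B = q\<^sup>2 * (?B + 1 / q - \<sigma> * N)"
      using assms(1) N(2) by (simp add: field_simps power2_eq_square)
    ultimately show ?thesis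
      using assms(1) N by (simp add: power2_eq_square power3_eq_cube)
  qed
  have first: "c k * D k m = W * q\<^sup>2 * (1 - \<tau> * (q * N)) * (q - \<tau> * (q * N)) * S k"
    if "m = Suc (Suc k)" "N = q ^ k" for k N
  proof -
    have N: "N \<noteq> 0" "M = q\<^sup>2 * N" "1 - \<tau> * N \<noteq> 0" "1 - \<tau> * (q * N) \<noteq> 0"
      using that assms(1) \<tau>[of k] \<tau>[of "Suc k"] by (simp_all add: M_def power2_eq_square)
    have "D k m = (1 - \<sigma> * N) * (1 - \<sigma> * (q * N)) / (q * N ^ 3)"
      by (simp add: that(1) D_def op_coeff_def Let_def mult.assoc flip: that(2))
    moreover have "c k = qpoch \<sigma> q k / qpoch \<tau> q k * N * S k"
      by (simp add: c_def series_coeff_def S_def that(2))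
    moreover have "W = qpoch \<sigma> q k * (1 - \<sigma> * N) * (1 - \<sigma> * (q * N))
                       / (qpoch \<tau> q k * (1 - \<tau> * N) * (1 - \<tau> * (q * N))) / (q\<^sup>2 * N)\<^sup>2"
      unfolding W_def N(2) by (simp add: that(1) qpoch_Suc flip: that(2))
    moreover have "q - \<tau> * (q * N) = q * (1 - \<tau> * N)"
      by (simp add: algebra_simps)
    ultimately show ?thesis
      using assms(1) N by (simp add: power2_eq_square power3_eq_cube, simp add: mult_ac)
  qed
  show ?thesis
  proof (cases m)
    case 0
    have set: "{m - 2..m + 1} = {m, Suc m}"
      using 0 by auto
    have sum: "(\<Sum>n = m - 2..m + 1. c n * D n m) = c m * D m m + c (Suc m) * D (Suc m) m"
      unfolding set by simp
    have "M = 1" "(1 - q * M) * (1 - \<rho> * M) * S (Suc m) - mid_coeff q \<tau> \<rho> \<mu> M * S m = 0"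
      using R[of m] 0 by (simp_all add: M_def)
    then show ?thesis
      unfolding sum diag last by algebra
  next
    case m: (Suc k)
    define N where "N = q ^ k"
    have MN: "M = q * N" by (simp add: M_def N_def m)
    have R2: "(1 - q * M) * (1 - \<rho> * M) * S (Suc m) - mid_coeff q \<tau> \<rho> \<mu> M * S m + (q - \<tau> * M) * S k = 0"
      using R[of m] by (simp add: M_def m)
    show ?thesis
    proof (cases k)
      case 0
      have set: "{m - 2..m + 1} = {k, m, Suc m}"
        using 0 m by auto
      have sum: "(\<Sum>n = m - 2..m + 1. c n * D n m)
          = c k * D k m + c m * D m m + c (Suc m) * D (Suc m) m"
        unfolding set using m by simp
      have "N = 1" "(1 - M) * (1 - \<rho> * N) * S m - mid_coeff q \<tau> \<rho> \<mu> N * S k = 0"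
        using R[of k] 0 by (simp_all add: M_def N_def m)
      then show ?thesis
        unfolding sum prev[OF m N_def] diag last using R2 MN by algebra
    next
      case k: (Suc j)
      have set: "{m - 2..m + 1} = {j, k, m, Suc m}"
        using k m by auto
      have sum: "(\<Sum>n = m - 2..m + 1. c n * D n m) = c j * D j m + c k * D k m + c m * D m m + c (Suc m) * D (Suc m) m"
        unfolding set using k m by simp
      have "q * q ^ j = N" by (simp add: N_def k)
      then have f: "c j * D j m = W * q\<^sup>2 * (1 - \<tau> * N) * (q - \<tau> * N) * S j"
        using first[of j "q ^ j"] k m by simp
      have R1: "(1 - M) * (1 - \<rho> * N) * S m - mid_coeff q \<tau> \<rho> \<mu> N * S k + (q - \<tau> * N) * S j = 0"
        using R[of k] k by (simp add: M_def N_def m)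
      show ?thesis
        unfolding sum f prev[OF m N_def] diag last using R1 R2 MN by algebra
    qed
  qed
qed

section \<open>Reduction to four parameters\<close>

lemma qpow_arith:
  "qpow lq (r + s) = qpow lq r * qpow lq s"
  "qpow lq (r - s) = qpow lq r / qpow lq s"
  "qpow lq (- s) = 1 / qpow lq s"
  "qpow lq r \<noteq> 0"
  by (simp_all add: qpow_def ring_distribs exp_add exp_diff exp_minus inverse_eq_divide)

lemma qpow_half: "qpow lq s = (qpow lq (s / 2))\<^sup>2"
  by (simp add: qpow_def power2_eq_square mult.commute flip: exp_add)

text \<open>
  The value of \<open>\<lambda>\<close> is what makes the coefficients of the equation rational in \<open>\<sigma>, \<tau>, \<rho>, \<mu>, q, a\<close>, up to
  the factor \<open>q\<^bsup>\<alpha>\<^sub>1\<^esup>\<close>: for instance \<open>q\<^bsup>\<alpha>\<^sub>2\<^esup> = q\<^bsup>\<alpha>\<^sub>1\<^esup> \<rho> / (\<sigma> \<mu>)\<close>, and the second zero \<open>q\<^bsup>h\<^sub>i'+1/2\<^esup> t\<^sub>i'\<close> of the coefficient of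
  \<open>g(x/q)\<close> is \<open>a \<sigma> q / (\<tau> \<mu>)\<close>, while those of the coefficient of \<open>g(q x)\<close> are \<open>a / \<rho>\<close> and \<open>a / \<tau>\<close>.
\<close>

lemma qhg2_op_eq_reduced_op:
  fixes lam :: complex
  assumes "q \<noteq> 0" "exp lq = q" "t 1 \<noteq> 0" "t 2 \<noteq> 0"
    and "(i, i') = (1, 2) \<or> (i, i') = (2, 1)"
    and lam: "lam = (h 1 + h 2 - l 1 - l 2 - \<alpha> 1 - \<alpha> 2 + 1) / 2"
    and u: "is_q_power q lq (- \<alpha> 1) u" and "x \<noteq> 0"
  defines "a \<equiv> qpow lq (h i + 1/2) * t i"
    and "\<sigma> \<equiv> qpow lq (lam + \<alpha> 1)"
    and "\<tau> \<equiv> qpow lq (h i - l i' + 1) * t i / t i'"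
    and "\<rho> \<equiv> qpow lq (h i - l i + 1)"
    and "\<mu> \<equiv> qpow lq (lam - h i' + l i' + \<alpha> 1)"
  shows "qhg2_op q lq h l t \<alpha> (\<lambda>y. u y * f (a / y)) x
           = qpow lq (\<alpha> 1) / (\<sigma> * \<tau> * \<mu>) * (x\<^sup>2 * u x) * reduced_op q \<sigma> \<tau> \<rho> \<mu> f (a / x)"
proof -
  \<comment> \<open>\<open>p\<close> and \<open>\<lambda>\<close> contain half the exponents, so all powers are monomials in these seven quantities,
    and the identities below become identities of rational functions.\<close>
  define H H' L L' A A' s where half:
    "H = qpow lq (h i / 2)" "H' = qpow lq (h i' / 2)" "L = qpow lq (l i / 2)" "L' = qpow lq (l i' / 2)"
    "A = qpow lq (\<alpha> 1 / 2)" "A' = qpow lq (\<alpha> 2 / 2)" "s = qpow lq (1 / 2)"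
  have nz: "H \<noteq> 0" "H' \<noteq> 0" "L \<noteq> 0" "L' \<noteq> 0" "A \<noteq> 0" "A' \<noteq> 0" "s \<noteq> 0" "t i \<noteq> 0" "t i' \<noteq> 0"
    using assms(3-5) by (auto simp: half qpow_arith)
  have full: "qpow lq (h i) = H\<^sup>2" "qpow lq (h i') = H'\<^sup>2" "qpow lq (l i) = L\<^sup>2" "qpow lq (l i') = L'\<^sup>2"
    "qpow lq (\<alpha> 1) = A\<^sup>2" "qpow lq (\<alpha> 2) = A'\<^sup>2" "qpow lq 1 = s\<^sup>2"
    unfolding half by (rule qpow_half)+
  have q: "q = s\<^sup>2"
    using assms(2) full(7) by (simp add: qpow_def)
  have lam': "lam = h i / 2 + h i' / 2 - l i / 2 - l i' / 2 - \<alpha> 1 / 2 - \<alpha> 2 / 2 + 1 / 2"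
    using assms(5) by (auto simp: lam add_divide_distrib diff_divide_distrib)
  have a: "a = H\<^sup>2 * s * t i"
    by (simp add: a_def qpow_arith full flip: half)
  have \<sigma>: "\<sigma> = H * H' * A * s / (L * L' * A')"
    unfolding \<sigma>_def lam' using nz by (simp add: qpow_arith full power2_eq_square mult_ac del: One_nat_def flip: half)
  have \<tau>: "\<tau> = H\<^sup>2 * s\<^sup>2 * t i / (L'\<^sup>2 * t i')"
    using nz by (simp add: \<tau>_def qpow_arith full)
  have \<rho>: "\<rho> = H\<^sup>2 * s\<^sup>2 / L\<^sup>2"
    by (simp add: \<rho>_def qpow_arith full)
  have \<mu>: "\<mu> = H * A * s * L' / (H' * L * A')"
    unfolding \<mu>_def lam' using nz by (simp add: qpow_arith full power2_eq_square mult_ac del: One_nat_def flip: half)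
  define p where "p = H * H' * L * L' * A * A'"
  have p: "qpow lq ((h 1 + h 2 + l 1 + l 2 + \<alpha> 1 + \<alpha> 2) / 2) = p"
    using assms(5) by (auto simp: p_def half qpow_arith add_divide_distrib)
  have E: "(qpow lq (- h 2) + qpow lq (- l 2)) * t 1 + (qpow lq (- h 1) + qpow lq (- l 1)) * t 2
      = (1 / H'\<^sup>2 + 1 / L'\<^sup>2) * t i + (1 / H\<^sup>2 + 1 / L\<^sup>2) * t i'"
    unfolding full[symmetric] using assms(5) by (auto simp: qpow_arith)
  have symm: "(x - qpow lq (h 1 + 1/2) * t 1) * (x - qpow lq (h 2 + 1/2) * t 2)
      = (x - H\<^sup>2 * s * t i) * (x - H'\<^sup>2 * s * t i')"
    "(x - qpow lq (l 1 - 1/2) * t 1) * (x - qpow lq (l 2 - 1/2) * t 2)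
      = (x - L\<^sup>2 / s * t i) * (x - L'\<^sup>2 / s * t i')"
    "t 1 * t 2 = t i * t i'"
    unfolding half qpow_half[symmetric] using assms(5) by (auto simp: qpow_arith mult.commute)
  have u': "u (q * x) = u x / A\<^sup>2" "u (x / q) = A\<^sup>2 * u x"
    using u \<open>x \<noteq> 0\<close> by (simp_all add: is_q_power_def qpow_arith full del: One_nat_def)
  let ?\<kappa> = "A\<^sup>2 / (\<sigma> * \<tau> * \<mu>)" and ?y = "a / x"
  \<comment> \<open>The coefficients of \<open>g(x/q)\<close>, \<open>g(q x)\<close> and of the three powers of \<open>x\<close> in front of \<open>g(x)\<close>.\<close>
  have minus: "(x - H\<^sup>2 * s * t i) * (x - H'\<^sup>2 * s * t i') * A\<^sup>2
      = ?\<kappa> * x\<^sup>2 * (\<sigma> * (1 - ?y) * (\<tau> * \<mu> - \<sigma> * q * ?y))"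
    using nz \<open>x \<noteq> 0\<close> unfolding a \<sigma> \<tau> \<mu> q by (simp add: field_simps power2_eq_square)
  have plus: "A'\<^sup>2 * ((x - L\<^sup>2 / s * t i) * (x - L'\<^sup>2 / s * t i'))
      = ?\<kappa> * x\<^sup>2 * ((\<rho> - ?y) * (\<tau> - ?y))"
    using nz \<open>x \<noteq> 0\<close> unfolding a \<sigma> \<tau> \<mu> \<rho> q by (simp add: field_simps power2_eq_square)
  have k0: "A\<^sup>2 + A'\<^sup>2 = ?\<kappa> * (\<sigma> * \<tau> * \<mu> + \<rho> * \<tau>)"
    using nz unfolding \<sigma> \<tau> \<mu> \<rho> by (simp add: field_simps power2_eq_square)
  have k1: "p * ((1 / H'\<^sup>2 + 1 / L'\<^sup>2) * t i + (1 / H\<^sup>2 + 1 / L\<^sup>2) * t i')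
      = ?\<kappa> * a * (\<sigma> * (q + \<rho> + \<tau>) + \<tau> * \<mu>)"
    using nz unfolding p_def a \<sigma> \<tau> \<mu> \<rho> q by (simp add: field_simps power2_eq_square)
  have k2: "p * (s + 1 / s) * (t i * t i') = ?\<kappa> * a\<^sup>2 * (\<sigma> * (1 + q))"
    using nz unfolding p_def a \<sigma> \<tau> \<mu> q by (simp add: field_simps power2_eq_square)
  have fs: "a / (x / q) = q * ?y" "a / (q * x) = ?y / q"
    by simp_all
  have sq: "?\<kappa> * x\<^sup>2 * ?y = ?\<kappa> * a * x" "?\<kappa> * x\<^sup>2 * ?y\<^sup>2 = ?\<kappa> * a\<^sup>2"
    using \<open>x \<noteq> 0\<close> by (simp_all add: power2_eq_square mult_ac)
  have "qhg2_op q lq h l t \<alpha> (\<lambda>y. u y * f (a / y)) x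
      = ((x - H\<^sup>2 * s * t i) * (x - H'\<^sup>2 * s * t i') * A\<^sup>2) * u x * f (q * ?y)
        + (A'\<^sup>2 * ((x - L\<^sup>2 / s * t i) * (x - L'\<^sup>2 / s * t i'))) * u x * f (?y / q)
        - ((A\<^sup>2 + A'\<^sup>2) * x\<^sup>2 
           - (p * ((1 / H'\<^sup>2 + 1 / L'\<^sup>2) * t i + (1 / H\<^sup>2 + 1 / L\<^sup>2) * t i')) * x
           + p * (s + 1 / s) * (t i * t i')) * (u x * f ?y)"
    unfolding qhg2_op_def Let_def p E[symmetric] symm[symmetric] u' fs
    using nz by (simp add: qpow_arith full half(7)[symmetric] del: One_nat_def)
  also have "\<dots> = ?\<kappa> * (x\<^sup>2 * u x) * reduced_op q \<sigma> \<tau> \<rho> \<mu> f ?y"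
    unfolding minus plus k0 k1 k2 reduced_op_def using sq by algebra
  finally show ?thesis
    by (simp add: full del: One_nat_def)
qed

section \<open>The formal solution\<close>

theorem theorem3p4:
  fixes q lq lam :: complex
    and h l t \<alpha> :: "nat \<Rightarrow> complex"
    and i i' :: nat
    and u :: "complex \<Rightarrow> complex"
  assumes "q \<noteq> 0" and "exp lq = q" and "\<And>n. n \<ge> 1 \<Longrightarrow> q ^ n \<noteq> 1"
    and "t 1 \<noteq> 0" and "t 2 \<noteq> 0"
    and "(i, i') = (1, 2) \<or> (i, i') = (2, 1)"
    and "lam = (h 1 + h 2 - l 1 - l 2 - \<alpha> 1 - \<alpha> 2 + 1) / 2"
    and "\<And>n. qpoch (qpow lq (h i - l i' + 1) * t i / t i') q n \<noteq> 0"
    and "\<And>n. qpoch (qpow lq (h i - l i + 1)) q n \<noteq> 0"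
    and "is_q_power q lq (- \<alpha> 1) u"
  shows "formal_solution (qhg2_op q lq h l t \<alpha>) u
    (\<lambda>n x. qpoch (qpow lq (h i + 1/2) * t i / x) q n)
    (\<lambda>n. qpoch (qpow lq (lam + \<alpha> 1)) q n
         / qpoch (qpow lq (h i - l i' + 1) * t i / t i') q n * q ^ n
         * (\<Sum>k = 0..n. qpoch (qpow lq (lam - h i' + l i' + \<alpha> 1)) q k
              / (qpoch (qpow lq (h i - l i + 1)) q k * qpoch q q k * qpoch q q (n - k))
              * q ^ (k * (k + 1) div 2)
              * (- qpow lq (h i - l i') * t i / t i') ^ k))"
proof -
  define a \<sigma> \<tau> \<rho> \<mu> where params:
    "a = qpow lq (h i + 1/2) * t i" "\<sigma> = qpow lq (lam + \<alpha> 1)"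
    "\<tau> = qpow lq (h i - l i' + 1) * t i / t i'" "\<rho> = qpow lq (h i - l i + 1)"
    "\<mu> = qpow lq (lam - h i' + l i' + \<alpha> 1)"
  have "qpow lq 1 = q"
    using assms(2) by (simp add: qpow_def)
  then have base: "- qpow lq (h i - l i') * t i / t i' = - \<tau> / q"
    using assms(1) by (simp add: params qpow_arith)
  let ?c = "series_coeff q \<sigma> \<tau> \<rho> \<mu>" and ?P = "\<lambda>n x. qpoch (a / x) q n"
  let ?\<kappa> = "qpow lq (\<alpha> 1) / (\<sigma> * \<tau> * \<mu>)"
  let ?d = "\<lambda>n m. ?\<kappa> * (?c n * op_coeff q \<sigma> \<tau> \<rho> \<mu> n m)"
  have "formal_solution (qhg2_op q lq h l t \<alpha>) u ?P ?c"
    unfolding formal_solution_def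
  proof (intro exI[of _ ?d] conjI allI impI)
    fix n and x :: complex
    assume x: "x \<noteq> 0"
    then have "u x \<noteq> 0"
      using assms(10) by (simp add: is_q_power_def)
    have "qhg2_op q lq h l t \<alpha> (\<lambda>y. u y * (?c n * ?P n y)) x
            = ?\<kappa> * (x\<^sup>2 * u x) * reduced_op q \<sigma> \<tau> \<rho> \<mu> (\<lambda>y. ?c n * qpoch y q n) (a / x)"
      unfolding params
      by (rule qhg2_op_eq_reduced_op[OF assms(1,2,4-7,10) x, where f = "\<lambda>y. ?c n * qpoch y q n", unfolded params])
    also have "reduced_op q \<sigma> \<tau> \<rho> \<mu> (\<lambda>y. ?c n * qpoch y q n) (a / x)
            = ?c n * reduced_op q \<sigma> \<tau> \<rho> \<mu> (\<lambda>y. qpoch y q n) (a / x)"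
      by (simp add: reduced_op_def algebra_simps)
    also have "\<dots> = ?c n * (\<Sum>m = n - 1..n + 2. op_coeff q \<sigma> \<tau> \<rho> \<mu> n m * ?P m x)"
      by (simp only: reduced_op_qpoch[OF assms(1)])
    also have "?\<kappa> * (x\<^sup>2 * u x) * \<dots> = (\<Sum>m = n - 1..n + 2. ?d n m * ?P m x) * (x\<^sup>2 * u x)"
      by (simp add: sum_distrib_left sum_distrib_right mult_ac del: sum.cl_ivl_Suc)
    finally show "qhg2_op q lq h l t \<alpha> (\<lambda>y. u y * (?c n * ?P n y)) x / (x\<^sup>2 * u x)
            = (\<Sum>m = n - 1..n + 2. ?d n m * ?P m x)"
      using x \<open>u x \<noteq> 0\<close> by (simp del: sum.cl_ivl_Suc)
  next
    fix m
    show "(\<Sum>n = m - 2..m + 1. ?d n m) = 0"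
      using series_coeff_recurrence[OF assms(1,3), of \<rho> \<tau> \<sigma> \<mu> m] assms(8,9)
      by (simp only: params simp_thms mult_zero_right flip: sum_distrib_left)
  qed
  then show ?thesis
    unfolding series_coeff_def inner_sum_def numer_coeff_def base[symmetric] 
    by (simp add: params)
qed

end
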